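(* Let $\mathcal{M}=\langle X,\mathcal{T},i\rangle$ be a topological model. Let $\mathcal{F}_{\mathcal{M}}$ be the least family of subsets of $X$ that contains $i(A)$ for every atomic formula $A\in\mathsf{A}$ and is closed under complements in $X$, (binary) intersections and interiors (with respect to $\mathcal{T}$), and let $\mathcal{F}^{\circ}_{\mathcal{M}}=\{S^{\circ}\mid S\in\mathcal{F}_{\mathcal{M}}\}$, where $S^\circ$ is the interior of $S$. Then there exists a family $\{\mathcal{F}^{\psi}\}_{\psi\in\mathcal{L}}$, where each $\mathcal{F}^\psi$ is a finite stable splitting for $\psi$, such that 1. $\mathcal{F}^{\psi}\subseteq\mathcal{F}^{\circ}_{\mathcal{M}}$ and $X\in\mathcal{F}^{\psi}$ for all $\psi\in\mathcal{L}$; 2. for all $\psi\in\mathcal{L}$, if $U\in\mathcal{F}^{\psi}$ then $U^{\psi}=\{x\in U\mid x,U\models_{\mathcal{M}}\psi\}\in\mathcal{F}_{\mathcal{M}}$; and 3. if $\phi$ is a subformula of $\psi$ then $\mathcal{F}^{\phi}\subseteq\mathcal{F}^{\psi}$ and $\mathcal{F}^{\psi}$ is a finite stable splitting for $\phi$.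
   Context: Language: $\mathsf{A}$ is a countable set of atomic formulae with two distinguished elements $\top,\bot$. $\mathcal{L}$ is the least set containing $\mathsf{A}$ and closed under $\phi\land\psi$, $\neg\phi$, $\Box\phi$, $\mathsf{K}\phi$. Models: a subset space is a pair $\langle X,\mathcal{O}\rangle$ with $\mathcal{O}\subseteq\mathcal{P}(X)$ and $X\in\mathcal{O}$. A model is $\langle X,\mathcal{O},i\rangle$ with $\langle X,\mathcal{O}\rangle$ a subset space and $i:\mathsf{A}\to\mathcal{P}(X)$ with $i(\top)=X$, $i(\bot)=\emptyset$. It is a topological model if $\mathcal{O}$ is a topology on $X$. Satisfaction in a model $\mathcal{M}=\langle X,\mathcal{O},i\rangle$ is defined for pairs $(x,U)$ with $x\in U\in\mathcal{O}$: $x,U\models A$ iff $x\in i(A)$ for atomic $A$; Boolean connectives as usual; $x,U\models\mathsf{K}\phi$ iff $y,U\models\phi$ for all $y\in U$; $x,U\models\Box\phi$ iff $x,V\models\phi$ for all $V\in\mathcal{O}$ with $x\in V\subseteq U$. Splittings: for $U\in\mathcal{T}$ let ${\downarrow}U=\{V\in\mathcal{T}\mid V\subseteq U\}$. For a finite family $\mathcal{F}\subseteq\mathcal{T}$ and $U\in\mathcal{F}$, the remainder is $\mathsf{Rem}^{\mathcal{F}}U={\downarrow}U-\bigcup\{{\downarrow}U'\mid U'\in\mathcal{F},\ U\not\subseteq U'\}$. A finite splitting is a finite family of open sets closed under intersection. A set $\mathcal{G}$ of opens is stable for $\phi$ if for every $x\in X$, either $x,V\models\phi$ for all $V\in\mathcal{G}$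 with $x\in V$, or $x,V\models\neg\phi$ for all $V\in\mathcal{G}$ with $x\in V$. A finite splitting $\mathcal{F}$ is a (finite) stable splitting for $\phi$ if $\mathsf{Rem}^{\mathcal{F}}U$ is stable for $\phi$ for every $U\in\mathcal{F}$. *)

theory Defs
  imports "HOL-Analysis.Abstract_Topology" "HOL-Library.Countable"
begin

text \<open>
  The atomic formulae are the elements of a type \<open>'a\<close>; countability is the sort \<open>countable\<close>, imposed
  where the atoms are quantified. The distinguished atoms for truth and falsity are parameters
  \<open>tt\<close> and \<open>ff\<close>.
\<close>

datatype 'a fm =
    Atom 'a
  | Conj "'a fm" "'a fm"
  | Neg "'a fm"
  | Box "'a fm"
  | Know "'a fm"

primrec subformulas :: "'a fm \<Rightarrow> 'a fm set" where
  "subformulas (Atom A) = {Atom A}"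
| "subformulas (Conj \<phi> \<psi>) = insert (Conj \<phi> \<psi>) (subformulas \<phi> \<union> subformulas \<psi>)"
| "subformulas (Neg \<phi>) = insert (Neg \<phi>) (subformulas \<phi>)"
| "subformulas (Box \<phi>) = insert (Box \<phi>) (subformulas \<phi>)"
| "subformulas (Know \<phi>) = insert (Know \<phi>) (subformulas \<phi>)"

definition subset_space :: "'x set \<Rightarrow> 'x set set \<Rightarrow> bool" where
  "subset_space X Os \<longleftrightarrow> Os \<subseteq> Pow X \<and> X \<in> Os"

definition subset_space_model ::
    "'a \<Rightarrow> 'a \<Rightarrow> 'x set \<Rightarrow> 'x set set \<Rightarrow> ('a \<Rightarrow> 'x set) \<Rightarrow> bool" where
  "subset_space_model tt ff X Os i \<longleftrightarrow>
     subset_space X Os \<and> (\<forall>A. i A \<subseteq> X) \<and> i tt = X \<and> i ff = {}"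

text \<open>
  Together with \<open>Os \<subseteq> Pow X\<close> and \<open>X \<in> Os\<close>, the predicate \<open>istopology\<close> says that \<open>Os\<close> is a topology
  with underlying set \<open>X\<close>.
\<close>

definition topological_model ::
    "'a \<Rightarrow> 'a \<Rightarrow> 'x set \<Rightarrow> 'x set set \<Rightarrow> ('a \<Rightarrow> 'x set) \<Rightarrow> bool" where
  "topological_model tt ff X Os i \<longleftrightarrow>
     subset_space_model tt ff X Os i \<and> istopology (\<lambda>U. U \<in> Os)"

text \<open>Satisfaction is meaningful only at pairs with \<open>x \<in> U\<close> and \<open>U \<in> Os\<close>.\<close>

primrec sat :: "'x set set \<Rightarrow> ('a \<Rightarrow> 'x set) \<Rightarrow> 'x \<Rightarrow> 'x set \<Rightarrow> 'a fm \<Rightarrow> bool" where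
  "sat Os i x U (Atom A) \<longleftrightarrow> x \<in> i A"
| "sat Os i x U (Conj \<phi> \<psi>) \<longleftrightarrow> sat Os i x U \<phi> \<and> sat Os i x U \<psi>"
| "sat Os i x U (Neg \<phi>) \<longleftrightarrow> \<not> sat Os i x U \<phi>"
| "sat Os i x U (Box \<phi>) \<longleftrightarrow> (\<forall>V\<in>Os. x \<in> V \<and> V \<subseteq> U \<longrightarrow> sat Os i x V \<phi>)"
| "sat Os i x U (Know \<phi>) \<longleftrightarrow> (\<forall>y\<in>U. sat Os i y U \<phi>)"

definition down :: "'x set set \<Rightarrow> 'x set \<Rightarrow> 'x set set" where
  "down T U = {V \<in> T. V \<subseteq> U}"

definition Rem :: "'x set set \<Rightarrow> 'x set set \<Rightarrow> 'x set \<Rightarrow> 'x set set" where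
  "Rem T F U = down T U - \<Union> {down T U' | U'. U' \<in> F \<and> \<not> U \<subseteq> U'}"

definition finite_splitting :: "'x set set \<Rightarrow> 'x set set \<Rightarrow> bool" where
  "finite_splitting T F \<longleftrightarrow> finite F \<and> F \<subseteq> T \<and> (\<forall>U\<in>F. \<forall>V\<in>F. U \<inter> V \<in> F)"

definition stable ::
    "'x set \<Rightarrow> 'x set set \<Rightarrow> ('a \<Rightarrow> 'x set) \<Rightarrow> 'x set set \<Rightarrow> 'a fm \<Rightarrow> bool" where
  "stable X T i G \<phi> \<longleftrightarrow>
     (\<forall>x\<in>X. (\<forall>V\<in>G. x \<in> V \<longrightarrow> sat T i x V \<phi>) \<or> (\<forall>V\<in>G. x \<in> V \<longrightarrow> sat T i x V (Neg \<phi>)))"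

definition finite_stable_splitting ::
    "'x set \<Rightarrow> 'x set set \<Rightarrow> ('a \<Rightarrow> 'x set) \<Rightarrow> 'x set set \<Rightarrow> 'a fm \<Rightarrow> bool" where
  "finite_stable_splitting X T i F \<phi> \<longleftrightarrow>
     finite_splitting T F \<and> (\<forall>U\<in>F. stable X T i (Rem T F U) \<phi>)"

abbreviation interior_in :: "'x set set \<Rightarrow> 'x set \<Rightarrow> 'x set" where
  "interior_in T S \<equiv> topology (\<lambda>U. U \<in> T) interior_of S"

inductive_set model_sets :: "'x set \<Rightarrow> 'x set set \<Rightarrow> ('a \<Rightarrow> 'x set) \<Rightarrow> 'x set set"
  for X :: "'x set" and T :: "'x set set" and i :: "'a \<Rightarrow> 'x set" where
  atom: "i A \<in> model_sets X T i"
| compl: "S \<in> model_sets X T i \<Longrightarrow> X - S \<in> model_sets X T i"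
| inter: "S \<in> model_sets X T i \<Longrightarrow> S' \<in> model_sets X T i \<Longrightarrow> S \<inter> S' \<in> model_sets X T i"
| interior: "S \<in> model_sets X T i \<Longrightarrow> interior_in T S \<in> model_sets X T i"

definition model_opens :: "'x set \<Rightarrow> 'x set set \<Rightarrow> ('a \<Rightarrow> 'x set) \<Rightarrow> 'x set set" where
  "model_opens X T i = {interior_in T S | S. S \<in> model_sets X T i}"

end

theory Submission
  imports Defs
begin

text \<open>
  If \<open>F\<close> is a finite splitting containing \<open>X\<close>, every open \<open>V\<close> lies in the remainder of exactly one
  member of \<open>F\<close>, namely of the least member above \<open>V\<close>. So it suffices to refine the splitting of
  \<open>\<phi>\<close> by finitely many opens of the model that decide the new operator. For \<open>Know \<phi>\<close> these are the
  interiors of the sets \<open>W\<^sup>\<phi>\<close>: an open \<open>V\<close> in the remainder of \<open>W\<close> satisfies \<open>Know \<phi>\<close> iff it is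
  contained in the interior of \<open>W\<^sup>\<phi>\<close>. For \<open>Box \<phi>\<close> note that some open \<open>V\<close> with \<open>x \<in> V \<subseteq> U\<close> lies in
  the remainder of \<open>W\<close> iff \<open>x \<in> U \<inter> W\<close> and \<open>U \<inter> W\<close> itself lies in it; since \<open>U \<inter> W \<subseteq> W'\<close> means that \<open>U\<close>
  is contained in the interior of \<open>(X - W) \<union> W'\<close>, the finitely many Heyting implications between
  members of the splitting decide this.
\<close>

section \<open>Remainders and closure under finite meets\<close>

lemma Rem_iff:
  "V \<in> Rem T F U \<longleftrightarrow> V \<in> T \<and> V \<subseteq> U \<and> (\<forall>U'\<in>F. V \<subseteq> U' \<longrightarrow> U \<subseteq> U')"
  unfolding Rem_def down_def by blast

lemma Rem_subset_iff: "V \<in> Rem T F U \<Longrightarrow> W \<in> F \<Longrightarrow> V \<subseteq> W \<longleftrightarrow> U \<subseteq> W"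
  unfolding Rem_iff by blast

text \<open>A member of \<open>F\<close> above \<open>V\<close> is also a member of
  \<open>F'\<close>, hence lies above \<open>U'\<close>, and therefore above
  \<open>U\<close>.\<close>

lemma Rem_refine:
  "V \<in> Rem T F' U' \<Longrightarrow> U' \<in> Rem T F U \<Longrightarrow> F \<subseteq> F' \<Longrightarrow> V \<in> Rem T F U"
  unfolding Rem_iff by blast

text \<open>The factor \<open>X\<close> gives the empty meet the value \<open>X\<close>, since
  \<open>\<Inter>{}\<close> is the whole type.\<close>

definition meets :: "'x set \<Rightarrow> 'x set set \<Rightarrow> 'x set set" where
  "meets X G = (\<lambda>H. X \<inter> \<Inter>H) ` Pow G"

lemma finite_meets: "finite G \<Longrightarrow> finite (meets X G)"
  unfolding meets_def by simp

lemma space_in_meets: "X \<in> meets X G"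
  unfolding meets_def by (rule image_eqI[of _ _ "{}"]) auto

lemma subset_meets:
  assumes "G \<subseteq> Pow X"
  shows "G \<subseteq> meets X G"
proof
  fix U assume "U \<in> G"
  with assms have "U = X \<inter> \<Inter>{U}" "{U} \<in> Pow G" by auto
  then show "U \<in> meets X G" unfolding meets_def by blast
qed

lemma meets_Int:
  assumes "U \<in> meets X G" "V \<in> meets X G"
  shows "U \<inter> V \<in> meets X G"
proof -
  obtain H K where "H \<subseteq> G" "U = X \<inter> \<Inter>H" "K \<subseteq> G" "V = X \<inter> \<Inter>K"
    using assms unfolding meets_def by auto
  then have "U \<inter> V = X \<inter> \<Inter>(H \<union> K)" "H \<union> K \<in> Pow G" by auto
  then show ?thesis unfolding meets_def by blast
qed

section \<open>Opens and definable sets of a topological model\<close>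

locale top_model =
  fixes tt ff :: 'a and X :: "'x set" and T :: "'x set set" and i :: "'a \<Rightarrow> 'x set"
  assumes model: "topological_model tt ff X T i"
begin

abbreviation M :: "'x set set" where
  "M \<equiv> model_sets X T i"

abbreviation int :: "'x set \<Rightarrow> 'x set" where
  "int S \<equiv> interior_in T S"

definition ext :: "'x set \<Rightarrow> 'a fm \<Rightarrow> 'x set" where
  "ext U \<phi> = {x \<in> U. sat T i x U \<phi>}"

lemma ext_subset: "ext U \<phi> \<subseteq> U"
  unfolding ext_def by blast

lemma istop: "istopology (\<lambda>U. U \<in> T)"
  using model unfolding topological_model_def by blast

lemma openin_eq: "openin (topology (\<lambda>U. U \<in> T)) U \<longleftrightarrow> U \<in> T"
  using istop by (simp add: topology_inverse')

lemma opens_subset: "T \<subseteq> Pow X"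
  and space_open: "X \<in> T"
  and atom_subset: "i A \<subseteq> X"
  using model
  unfolding topological_model_def subset_space_model_def subset_space_def by auto

lemma open_Int: "U \<in> T \<Longrightarrow> V \<in> T \<Longrightarrow> U \<inter> V \<in> T"
  using istop unfolding istopology_def by blast

lemma int_open: "int S \<in> T"
  using openin_interior_of[of "topology (\<lambda>U. U \<in> T)" S] unfolding openin_eq .

lemma subset_int_iff: "U \<in> T \<Longrightarrow> U \<subseteq> int S \<longleftrightarrow> U \<subseteq> S"
  using interior_of_maximal_eq[of "topology (\<lambda>U. U \<in> T)" U S] openin_eq by blast

lemma space_M: "X \<in> M"
proof -
  have "i tt = X"
    using model unfolding topological_model_def subset_space_model_def by blast
  then show ?thesis using model_sets.atom[of i tt X T] by simp
qed

lemma empty_M: "{} \<in> M"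
  using model_sets.compl[OF space_M] by simp

lemma M_subset: "S \<in> M \<Longrightarrow> S \<subseteq> X"
proof (induction rule: model_sets.induct)
  case (interior S)
  then show ?case using int_open opens_subset by blast
qed (use atom_subset in auto)

lemma M_Un:
  assumes "S \<in> M" "S' \<in> M"
  shows "S \<union> S' \<in> M"
proof -
  have "S \<union> S' = X - ((X - S) \<inter> (X - S'))"
    using M_subset[OF assms(1)] M_subset[OF assms(2)] by blast
  then show ?thesis
    using assms by (simp add: model_sets.compl model_sets.inter)
qed

lemma M_Inter: "finite H \<Longrightarrow> H \<subseteq> M \<Longrightarrow> X \<inter> \<Inter>H \<in> M"
proof (induction rule: finite_induct)
  case empty
  then show ?case using space_M by simp
next
  case (insert S H)
  then show ?case
    using model_sets.inter[of S X T i "X \<inter> \<Inter>H"] by (simp add: Int_left_commute)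
qed

lemma T_Inter: "finite H \<Longrightarrow> H \<subseteq> T \<Longrightarrow> X \<inter> \<Inter>H \<in> T"
proof (induction rule: finite_induct)
  case empty
  then show ?case using space_open by simp
next
  case (insert S H)
  then show ?case using open_Int[of S "X \<inter> \<Inter>H"] by (simp add: Int_left_commute)
qed

text \<open>An open set is its own interior, so it witnesses its own membership.\<close>

lemma model_opensI: "U \<in> T \<Longrightarrow> U \<in> M \<Longrightarrow> U \<in> model_opens X T i"
  using interior_of_openin[of "topology (\<lambda>U. U \<in> T)" U] openin_eq[of U]
  unfolding model_opens_def by blast

section \<open>Splittings and adequacy\<close>

definition splitting :: "'x set set \<Rightarrow> bool" where
  "splitting F \<longleftrightarrow> finite F \<and> F \<subseteq> T \<inter> M \<and> X \<in> F \<and> (\<forall>U\<in>F. \<forall>V\<in>F. U \<inter> V \<in> F)"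

text \<open>The invariant of the induction on formulas: stability together with definability of
  extensions, which is needed to build the opens for \<open>Know\<close>. Each \<open>U\<close> in
  \<open>F\<close> lies in its own remainder, so stability can be phrased as agreement with the
  truth value at \<open>U\<close>.\<close>

definition adequate :: "'x set set \<Rightarrow> 'a fm \<Rightarrow> bool" where
  "adequate F \<phi> \<longleftrightarrow>
     splitting F \<and>
     (\<forall>U\<in>F. \<forall>V\<in>Rem T F U. \<forall>x\<in>V. sat T i x V \<phi> \<longleftrightarrow> sat T i x U \<phi>) \<and>
     (\<forall>U\<in>F. ext U \<phi> \<in> M)"

lemma adequate_splitting: "adequate F \<phi> \<Longrightarrow> splitting F"
  unfolding adequate_def by blast

lemma adequate_sat:
  "adequate F \<phi> \<Longrightarrow> U \<in> F \<Longrightarrow> V \<in> Rem T F U \<Longrightarrow> x \<in> V \<Longrightarrow> sat T i x V \<phi> \<longleftrightarrow> sat T i x U \<phi>"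
  unfolding adequate_def by blast

lemma adequate_ext: "adequate F \<phi> \<Longrightarrow> U \<in> F \<Longrightarrow> ext U \<phi> \<in> M"
  unfolding adequate_def by blast

lemma adequateI:
  assumes "splitting F"
    and "\<And>U V x. U \<in> F \<Longrightarrow> V \<in> Rem T F U \<Longrightarrow> x \<in> V \<Longrightarrow> sat T i x V \<phi> \<longleftrightarrow> sat T i x U \<phi>"
    and "\<And>U. U \<in> F \<Longrightarrow> ext U \<phi> \<in> M"
  shows "adequate F \<phi>"
  using assms unfolding adequate_def by blast

lemma splitting_meets:
  assumes "finite G" "G \<subseteq> T \<inter> M"
  shows "splitting (meets X G)"
proof -
  have "X \<inter> \<Inter>H \<in> T \<inter> M" if "H \<subseteq> G" for H
    using that assms T_Inter[of H] M_Inter[of H] finite_subset[of H G] by auto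
  then have "meets X G \<subseteq> T \<inter> M" unfolding meets_def by blast
  then show ?thesis
    unfolding splitting_def using finite_meets[OF assms(1)] space_in_meets meets_Int by blast
qed

lemma splitting_Inter:
  assumes "splitting F" "finite H" "H \<subseteq> F"
  shows "X \<inter> \<Inter>H \<in> F"
  using assms(2,3)
proof (induction rule: finite_induct)
  case empty
  then show ?case using assms(1) unfolding splitting_def by simp
next
  case (insert S H)
  then have "S \<inter> (X \<inter> \<Inter>H) \<in> F" using assms(1) unfolding splitting_def by auto
  then show ?case by (simp add: Int_left_commute)
qed

lemma open_in_Rem:
  assumes "splitting F" "V \<in> T"
  obtains W where "W \<in> F" "V \<in> Rem T F W"
proof
  let ?H = "{W \<in> F. V \<subseteq> W}"
  show "X \<inter> \<Inter>?H \<in> F"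
    using assms(1) by (intro splitting_Inter) (auto simp: splitting_def)
  show "V \<in> Rem T F (X \<inter> \<Inter>?H)"
    using assms(2) opens_subset unfolding Rem_iff by blast
qed

lemma finite_stable_splitting_adequate:
  assumes "adequate F \<phi>"
  shows "finite_stable_splitting X T i F \<phi>"
proof -
  have "finite_splitting T F"
    using adequate_splitting[OF assms] unfolding splitting_def finite_splitting_def by blast
  \<comment> \<open>The truth value at \<open>(x, U)\<close> selects which of the two alternatives
    holds.\<close>
  moreover have "stable X T i (Rem T F U) \<phi>" if "U \<in> F" for U
    using adequate_sat[OF assms that] unfolding stable_def by auto
  ultimately show ?thesis unfolding finite_stable_splitting_def by blast
qed

text \<open>Each \<open>U\<close> in \<open>F'\<close> lies in the remainder of some
  \<open>W\<close> in \<open>F\<close>, and by \<open>Rem_refine\<close> so does everything in the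
  remainder of \<open>U\<close>. Truth at all these opens is thus read off at
  \<open>W\<close>.\<close>

lemma adequate_mono:
  assumes ad: "adequate F \<phi>" and sub: "F \<subseteq> F'" and spl: "splitting F'"
  shows "adequate F' \<phi>"
proof (rule adequateI[OF spl])
  fix U assume U: "U \<in> F'"
  then have "U \<in> T" "U \<in> M" using spl unfolding splitting_def by auto
  then obtain W where W: "W \<in> F" "U \<in> Rem T F W"
    using open_in_Rem[OF adequate_splitting[OF ad]] by blast
  show "sat T i x V \<phi> \<longleftrightarrow> sat T i x U \<phi>" if V: "V \<in> Rem T F' U" and x: "x \<in> V" for V x
  proof -
    have "x \<in> U" using V x unfolding Rem_iff by blast
    then show ?thesis
      using adequate_sat[OF ad W(1) Rem_refine[OF V W(2) sub] x] adequate_sat[OF ad W] by simp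
  qed
  have "ext U \<phi> = U \<inter> ext W \<phi>"
    using adequate_sat[OF ad W] W(2) unfolding ext_def Rem_iff by blast
  then show "ext U \<phi> \<in> M"
    using \<open>U \<in> M\<close> adequate_ext[OF ad W(1)] by (simp add: model_sets.inter)
qed

section \<open>Atoms and Boolean connectives\<close>

lemma adequate_Atom: "adequate {X} (Atom A)"
proof (rule adequateI)
  show "splitting {X}" using space_open space_M unfolding splitting_def by simp
  have "ext X (Atom A) = i A" using atom_subset unfolding ext_def by auto
  then show "ext U (Atom A) \<in> M" if "U \<in> {X}" for U
    using that model_sets.atom[of i A] by simp
qed simp

lemma adequate_Conj:
  assumes "adequate F \<phi>" "adequate F \<psi>"
  shows "adequate F (Conj \<phi> \<psi>)"
proof (rule adequateI)
  show "ext U (Conj \<phi> \<psi>) \<in> M" if "U \<in> F" for U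
  proof -
    have "ext U (Conj \<phi> \<psi>) = ext U \<phi> \<inter> ext U \<psi>" unfolding ext_def by auto
    then show ?thesis
      using assms that by (simp add: adequate_ext model_sets.inter)
  qed
qed (use assms in \<open>auto simp: adequate_def\<close>)

lemma adequate_Neg:
  assumes "adequate F \<phi>"
  shows "adequate F (Neg \<phi>)"
proof (rule adequateI)
  show "ext U (Neg \<phi>) \<in> M" if "U \<in> F" for U
  proof -
    have U: "U \<in> M" using assms that unfolding adequate_def splitting_def by blast
    \<comment> \<open>The complement within \<open>U\<close> is expressed by the complement in
      \<open>X\<close>, the one under which \<open>M\<close> is closed.\<close>
    have "ext U (Neg \<phi>) = U \<inter> (X - ext U \<phi>)" using M_subset[OF U] unfolding ext_def by auto
    then show ?thesis
      using U adequate_ext[OF assms that] by (simp add: model_sets.compl model_sets.inter)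
  qed
qed (use assms in \<open>auto simp: adequate_def\<close>)

section \<open>The modal operators\<close>

definition know_opens :: "'x set set \<Rightarrow> 'a fm \<Rightarrow> 'x set set" where
  "know_opens F \<phi> = (\<lambda>W. int (ext W \<phi>)) ` F"

definition box_opens :: "'x set set \<Rightarrow> 'x set set" where
  "box_opens F = (\<lambda>(W, W'). int ((X - W) \<union> W')) ` (F \<times> F)"

lemma know_opens_finite_subset:
  assumes "adequate F \<phi>"
  shows "finite (know_opens F \<phi>)" "know_opens F \<phi> \<subseteq> T \<inter> M"
  using adequate_splitting[OF assms] adequate_ext[OF assms] int_open
  unfolding know_opens_def splitting_def by (auto intro: model_sets.interior)

lemma box_opens_finite_subset:
  assumes "splitting F"
  shows "finite (box_opens F)" "box_opens F \<subseteq> T \<inter> M"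
  using assms int_open unfolding box_opens_def splitting_def
  by (auto intro!: model_sets.interior M_Un model_sets.compl)

text \<open>Opens \<open>V\<close> in the \<open>F'\<close>-remainder of \<open>U\<close> share with
  \<open>U\<close> a remainder of \<open>F\<close>, say that of \<open>W\<close>. The test set
  \<open>int (ext W \<phi>)\<close> is a member of \<open>F'\<close>, so it contains
  \<open>V\<close> exactly when it contains \<open>U\<close>.\<close>

lemma adequate_Know:
  assumes ad: "adequate F \<phi>" and spl: "splitting F'"
    and sub: "F \<subseteq> F'" and know: "know_opens F \<phi> \<subseteq> F'"
  shows "adequate F' (Know \<phi>)"
proof (rule adequateI[OF spl])
  fix U assume U: "U \<in> F'"
  then have UT: "U \<in> T" "U \<in> M" using spl unfolding splitting_def by auto
  then obtain W where W: "W \<in> F" "U \<in> Rem T F W"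
    using open_in_Rem[OF adequate_splitting[OF ad]] by blast
  have sat_iff: "sat T i x V (Know \<phi>) \<longleftrightarrow> V \<subseteq> int (ext W \<phi>)"
    if V: "V \<in> Rem T F W" for V x
  proof -
    have "V \<in> T" "V \<subseteq> W" using V unfolding Rem_iff by auto
    have "sat T i x V (Know \<phi>) \<longleftrightarrow> (\<forall>y\<in>V. sat T i y W \<phi>)"
      using adequate_sat[OF ad W(1) V] by simp
    also have "\<dots> \<longleftrightarrow> V \<subseteq> ext W \<phi>" using \<open>V \<subseteq> W\<close> unfolding ext_def by blast
    finally show ?thesis using subset_int_iff[OF \<open>V \<in> T\<close>] by simp
  qed
  have "int (ext W \<phi>) \<in> F'" using know W(1) unfolding know_opens_def by blast
  then show "sat T i x V (Know \<phi>) \<longleftrightarrow> sat T i x U (Know \<phi>)" if V: "V \<in> Rem T F' U" for V x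
    using sat_iff[OF Rem_refine[OF V W(2) sub]] sat_iff[OF W(2)] Rem_subset_iff[OF V] by simp
  \<comment> \<open>Truth of \<open>Know \<phi>\<close> at \<open>U\<close> does not depend on the
    point.\<close>
  have "ext U (Know \<phi>) = U \<or> ext U (Know \<phi>) = {}" unfolding ext_def by auto
  then show "ext U (Know \<phi>) \<in> M" using UT(2) empty_M by auto
qed

text \<open>The quantifier over all opens below \<open>U\<close> reduces to the finitely many test
  opens \<open>U \<inter> W\<close>, because truth of \<open>\<phi>\<close> at an open in the
  remainder of \<open>W\<close> is truth at \<open>W\<close>.\<close>

lemma sat_Box_iff:
  assumes ad: "adequate F \<phi>" and U: "U \<in> T" and x: "x \<in> U"
  shows "sat T i x U (Box \<phi>) \<longleftrightarrow>
    (\<forall>W\<in>F. U \<inter> W \<in> Rem T F W \<longrightarrow> x \<in> W \<longrightarrow> x \<in> ext W \<phi>)"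
proof (intro iffI ballI impI)
  fix W assume box: "sat T i x U (Box \<phi>)" and W: "W \<in> F" "U \<inter> W \<in> Rem T F W" and xW: "x \<in> W"
  have "U \<inter> W \<in> T" using W(2) unfolding Rem_iff by blast
  then have "sat T i x (U \<inter> W) \<phi>" using box x xW by simp
  then show "x \<in> ext W \<phi>"
    using adequate_sat[OF ad W, of x] x xW unfolding ext_def by simp
next
  assume R: "\<forall>W\<in>F. U \<inter> W \<in> Rem T F W \<longrightarrow> x \<in> W \<longrightarrow> x \<in> ext W \<phi>"
  have "sat T i x V \<phi>" if V: "V \<in> T" "x \<in> V" "V \<subseteq> U" for V
  proof -
    obtain W where W: "W \<in> F" "V \<in> Rem T F W"
      using open_in_Rem[OF adequate_splitting[OF ad] V(1)] by blast
    then have "W \<in> T" using adequate_splitting[OF ad] unfolding splitting_def by blast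
    \<comment> \<open>Since \<open>V \<subseteq> U \<inter> W\<close>, a member of \<open>F\<close>
      above \<open>U \<inter> W\<close> is above \<open>V\<close>, hence above
      \<open>W\<close>.\<close>
    then have "U \<inter> W \<in> Rem T F W"
      using W(2) V(3) open_Int[OF U] unfolding Rem_iff by blast
    moreover have "x \<in> W" using V(2) W(2) unfolding Rem_iff by blast
    ultimately have "x \<in> ext W \<phi>" using R W(1) by blast
    then show ?thesis using adequate_sat[OF ad W V(2)] unfolding ext_def by simp
  qed
  then show "sat T i x U (Box \<phi>)" by simp
qed

text \<open>By \<open>sat_Box_iff\<close>, truth at \<open>V\<close> depends only on
  \<open>x\<close> and on which \<open>W\<close> have \<open>V \<inter> W\<close> in their
  remainder. This is a matter of inclusions \<open>V \<inter> W \<subseteq> W'\<close>, each tested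
  by a Heyting implication in \<open>F'\<close>, so \<open>V\<close> and \<open>U\<close> give the
  same answers.\<close>

lemma adequate_Box:
  assumes ad: "adequate F \<phi>" and spl: "splitting F'" and box: "box_opens F \<subseteq> F'"
  shows "adequate F' (Box \<phi>)"
proof (rule adequateI[OF spl])
  fix U assume U: "U \<in> F'"
  then have UT: "U \<in> T" "U \<in> M" using spl unfolding splitting_def by auto
  have F: "finite F" "F \<subseteq> T \<inter> M" using adequate_splitting[OF ad] unfolding splitting_def by auto
  show "sat T i x V (Box \<phi>) \<longleftrightarrow> sat T i x U (Box \<phi>)" if V: "V \<in> Rem T F' U" and x: "x \<in> V" for V x
  proof -
    have VT: "V \<in> T" "V \<subseteq> U" using V unfolding Rem_iff by auto
    have Int_subset_iff: "V \<inter> W \<subseteq> W' \<longleftrightarrow> U \<inter> W \<subseteq> W'" if W: "W \<in> F" "W' \<in> F" for W W'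
    proof -
      have heyting: "Y \<inter> W \<subseteq> W' \<longleftrightarrow> Y \<subseteq> int ((X - W) \<union> W')" if Y: "Y \<in> T" for Y
      proof -
        have "Y \<subseteq> X" using Y opens_subset by blast
        then show ?thesis unfolding subset_int_iff[OF Y] by blast
      qed
      have "int ((X - W) \<union> W') \<in> F'" using box W unfolding box_opens_def by blast
      then show ?thesis
        using heyting[OF VT(1)] heyting[OF UT(1)] Rem_subset_iff[OF V] by simp
    qed
    have "V \<inter> W \<in> Rem T F W \<longleftrightarrow> U \<inter> W \<in> Rem T F W" if W: "W \<in> F" for W
    proof -
      have "W \<in> T" using W F(2) by blast
      then have "V \<inter> W \<in> T" "U \<inter> W \<in> T" using open_Int VT(1) UT(1) by auto
      then show ?thesis unfolding Rem_iff using Int_subset_iff[OF W] by simp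
    qed
    then show ?thesis
      using sat_Box_iff[OF ad VT(1) x] sat_Box_iff[OF ad UT(1), of x] VT(2) x by blast
  qed
  \<comment> \<open>The criterion of \<open>sat_Box_iff\<close> as a set:
    \<open>x \<in> W \<longrightarrow> x \<in> ext W \<phi>\<close> becomes membership in a union.
    The relevant \<open>W\<close> depend on \<open>U\<close> alone, so the intersection is a finite
    one of sets in \<open>M\<close>.\<close>
  let ?H = "(\<lambda>W. (X - W) \<union> ext W \<phi>) ` {W \<in> F. U \<inter> W \<in> Rem T F W}"
  have "ext U (Box \<phi>) = U \<inter> (X \<inter> \<Inter>?H)"
  proof -
    have "x \<in> ext U (Box \<phi>) \<longleftrightarrow> x \<in> X \<inter> \<Inter>?H" if "x \<in> U" for x
      using sat_Box_iff[OF ad UT(1) that] that M_subset[OF UT(2)]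
      by (auto simp: ext_def simp del: sat.simps)
    then show ?thesis using ext_subset[of U "Box \<phi>"] by blast
  qed
  moreover have "?H \<subseteq> M"
    using F(2) adequate_ext[OF ad] by (auto intro!: M_Un model_sets.compl)
  ultimately show "ext U (Box \<phi>) \<in> M"
    using M_Inter[of ?H] F(1) UT(2) by (simp add: model_sets.inter)
qed

section \<open>The family of splittings, by recursion on formulas\<close>

primrec split_family :: "'a fm \<Rightarrow> 'x set set" where
  "split_family (Atom A) = {X}"
| "split_family (Conj \<phi> \<psi>) = meets X (split_family \<phi> \<union> split_family \<psi>)"
| "split_family (Neg \<phi>) = split_family \<phi>"
| "split_family (Box \<phi>) = meets X (split_family \<phi> \<union> box_opens (split_family \<phi>))"
| "split_family (Know \<phi>) = meets X (split_family \<phi> \<union> know_opens (split_family \<phi>) \<phi>)"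

lemma meets_Un:
  assumes "splitting F" "finite G" "G \<subseteq> T \<inter> M"
  shows "splitting (meets X (F \<union> G))" "F \<subseteq> meets X (F \<union> G)" "G \<subseteq> meets X (F \<union> G)"
proof -
  have "finite (F \<union> G)" "F \<union> G \<subseteq> T \<inter> M" using assms unfolding splitting_def by auto
  then show "splitting (meets X (F \<union> G))" "F \<subseteq> meets X (F \<union> G)" "G \<subseteq> meets X (F \<union> G)"
    using splitting_meets[of "F \<union> G"] subset_meets[of "F \<union> G" X] opens_subset by auto
qed

lemma split_family_Conj_mono:
  assumes "splitting (split_family \<phi>)" "splitting (split_family \<psi>)"
  shows "splitting (split_family (Conj \<phi> \<psi>))"
    "split_family \<phi> \<subseteq> split_family (Conj \<phi> \<psi>)" "split_family \<psi> \<subseteq> split_family (Conj \<phi> \<psi>)"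
  using meets_Un[of "split_family \<phi>" "split_family \<psi>"] assms unfolding splitting_def by simp_all

lemma adequate_split_family: "adequate (split_family \<psi>) \<psi>"
proof (induction \<psi>)
  case (Atom A)
  then show ?case using adequate_Atom by simp
next
  case (Conj \<phi> \<psi>)
  note mono = split_family_Conj_mono[OF Conj.IH[THEN adequate_splitting]]
  show ?case
    \<comment> \<open>Both induction hypotheses are first carried to the common refinement.\<close>
    using adequate_Conj adequate_mono[OF Conj.IH(1) mono(2,1)]
      adequate_mono[OF Conj.IH(2) mono(3,1)] by blast
next
  case (Neg \<phi>)
  then show ?case using adequate_Neg by simp
next
  case (Box \<phi>)
  note spl = adequate_splitting[OF Box]
  show ?case
    using adequate_Box[OF Box] meets_Un[OF spl box_opens_finite_subset[OF spl]] by simp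
next
  case (Know \<phi>)
  show ?case
    using adequate_Know[OF Know]
      meets_Un[OF adequate_splitting[OF Know] know_opens_finite_subset[OF Know]] by simp
qed

lemma splitting_split_family: "splitting (split_family \<psi>)"
  using adequate_splitting[OF adequate_split_family] .

text \<open>Every recursive clause keeps the members of the families of the immediate
  subformulas.\<close>

lemma split_family_subformula_mono:
  "\<phi> \<in> subformulas \<psi> \<Longrightarrow> split_family \<phi> \<subseteq> split_family \<psi>"
proof (induction \<psi>)
  case (Conj \<psi>1 \<psi>2)
  then show ?case
    using split_family_Conj_mono[OF splitting_split_family[of \<psi>1] splitting_split_family[of \<psi>2]]
    by (auto simp del: split_family.simps)
next
  case (Box \<psi>)
  note spl = splitting_split_family[of \<psi>]
  show ?case using Box meets_Un(2)[OF spl box_opens_finite_subset[OF spl]] by auto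
next
  case (Know \<psi>)
  show ?case
    using Know meets_Un(2)[OF splitting_split_family
        know_opens_finite_subset[OF adequate_split_family[of \<psi>]]] by auto
qed auto

end

theorem theorem15:
  fixes tt ff :: "'a::countable"
    and X :: "'x set" and T :: "'x set set" and i :: "'a \<Rightarrow> 'x set"
  assumes "tt \<noteq> ff"
    and "topological_model tt ff X T i"
  shows "\<exists>F :: 'a fm \<Rightarrow> 'x set set.
    (\<forall>\<psi>. finite_stable_splitting X T i (F \<psi>) \<psi>) \<and>
    (\<forall>\<psi>. F \<psi> \<subseteq> model_opens X T i \<and> X \<in> F \<psi>) \<and>
    (\<forall>\<psi>. \<forall>U \<in> F \<psi>. {x \<in> U. sat T i x U \<psi>} \<in> model_sets X T i) \<and>
    (\<forall>\<phi> \<psi>. \<phi> \<in> subformulas \<psi> \<longrightarrow>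
      F \<phi> \<subseteq> F \<psi> \<and> finite_stable_splitting X T i (F \<psi>) \<phi>)"
proof -
  interpret top_model tt ff X T i using assms(2) by unfold_locales
  show ?thesis
  proof (intro exI[of _ split_family] conjI allI ballI impI)
    fix \<phi> \<psi> :: "'a fm"
    show "finite_stable_splitting X T i (split_family \<psi>) \<psi>"
      using finite_stable_splitting_adequate[OF adequate_split_family] .
    show "split_family \<psi> \<subseteq> model_opens X T i" "X \<in> split_family \<psi>"
      using splitting_split_family[of \<psi>] model_opensI unfolding splitting_def by auto
    show "{x \<in> U. sat T i x U \<psi>} \<in> model_sets X T i" if "U \<in> split_family \<psi>" for U
      using adequate_ext[OF adequate_split_family that] unfolding ext_def .
    assume "\<phi> \<in> subformulas \<psi>"
    then show mono: "split_family \<phi> \<subseteq> split_family \<psi>"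
      by (rule split_family_subformula_mono)
    \<comment> \<open>Adequacy for \<open>\<phi>\<close> is carried along the inclusion just
      proved.\<close>
    show "finite_stable_splitting X T i (split_family \<psi>) \<phi>"
      using finite_stable_splitting_adequate
        adequate_mono[OF adequate_split_family mono splitting_split_family] .
  qed
qed

end
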